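(* Let $\mathcal G\neq\mathcal H$ be two distinct directed trees on the same vertex set $[m]$. Then the varieties $\mathcal V_{\varphi_{\mathcal G,c^*}}$ and $\mathcal V_{\varphi_{\mathcal H,c^*}}$ intersect in a strictly lower-dimensional variety: $$\dim\big(\mathcal V_{\varphi_{\mathcal G,c^*}}\cap\mathcal V_{\varphi_{\mathcal H,c^*}}\big)<\min\big(\dim\mathcal V_{\varphi_{\mathcal G,c^*}},\dim\mathcal V_{\varphi_{\mathcal H,c^*}}\big).$$ Moreover, the family of models $\{\mathcal M(\mathcal G,c^* ):\mathcal G\text{ a directed tree}\}$ is structurally identifiable: $\mathcal M(\mathcal G,c^* )\neq\mathcal M(\mathcal H,c^* )$.
   Context: A directed tree $\mathcal G=([m],E)$ is a directed acyclic graph on the labeled vertex set $[m]=\{1,\dots,m\}$ whose underlying undirected graph is a tree and which has a unique source node. A trek between $i$ and $j$ is a pair $T=\{P,Q\}$ of directed paths (length zero allowed) with a common starting node, $P$ ending at $i$ and $Q$ ending at $j$; its length is $|T|=|P|+|Q|$ (number of edges). Under the constant coloring $c^*$ all vertices share one parameter $\omega$ and all edges share one parameter $\lambda$, and the trek polynomial is $p_{i,j}=\sum_T\omega\lambda^{|T|}$, summed over all treks $T$ between $i$ and $j$ in $\mathcal G$. Let $\varphi_{\mathcal G,c^*}:\mathbb R^2\to\mathbb R^{\binom{m+1}{2}}$, $(\omega,\lambda)\mapsto(p_{i,j}(\omega,\lambda))_{1\le i\le j\le m}$. The model is $\mathcal M(\mathcal G,c^* )=\varphi_{\mathcal G,c^*}(\mathbb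 R_{\ge0}\times\mathbb R)$ and $\mathcal V_{\varphi_{\mathcal G,c^*}}$ is its Zariski closure, equivalently the Zariski closure of $\varphi_{\mathcal G,c^*}(\mathbb R^2)$. Dimension is that of (real) algebraic varieties. *)

theory Defs
  imports "HOL-Analysis.Abstract_Topology" "HOL-Library.Extended_Real" "HOL-Library.FuncSet"
    "Graph_Theory.Digraph_Component"
begin

section \<open>Zariski topology and dimension over the reals\<close>

text \<open>
  The affine space with finite coordinate set \<open>I\<close> is \<open>I \<rightarrow>\<^sub>E UNIV\<close>, the extensional functions
  from \<open>I\<close> to the reals.
\<close>

inductive_set poly_funs :: "'v set \<Rightarrow> (('v \<Rightarrow> real) \<Rightarrow> real) set" for I :: "'v set" where
  poly_const: "(\<lambda>x. c) \<in> poly_funs I"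
| poly_coord: "i \<in> I \<Longrightarrow> (\<lambda>x. x i) \<in> poly_funs I"
| poly_add: "f \<in> poly_funs I \<Longrightarrow> g \<in> poly_funs I \<Longrightarrow> (\<lambda>x. f x + g x) \<in> poly_funs I"
| poly_mult: "f \<in> poly_funs I \<Longrightarrow> g \<in> poly_funs I \<Longrightarrow> (\<lambda>x. f x * g x) \<in> poly_funs I"

definition zero_locus :: "'v set \<Rightarrow> (('v \<Rightarrow> real) \<Rightarrow> real) set \<Rightarrow> ('v \<Rightarrow> real) set" where
  "zero_locus I F = {x \<in> I \<rightarrow>\<^sub>E UNIV. \<forall>f\<in>F. f x = 0}"

definition zariski_topology :: "'v set \<Rightarrow> ('v \<Rightarrow> real) topology" where
  "zariski_topology I =
     topology (\<lambda>U. \<exists>F \<subseteq> poly_funs I. U = (I \<rightarrow>\<^sub>E UNIV) - zero_locus I F)"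

lemma istopology_zariski:
  "istopology (\<lambda>U. \<exists>F \<subseteq> poly_funs I. U = (I \<rightarrow>\<^sub>E UNIV) - zero_locus I F)"
  unfolding istopology_def
proof (intro conjI allI impI)
  fix S T :: "('a \<Rightarrow> real) set"
  assume "\<exists>F \<subseteq> poly_funs I. S = (I \<rightarrow>\<^sub>E UNIV) - zero_locus I F"
    and "\<exists>F \<subseteq> poly_funs I. T = (I \<rightarrow>\<^sub>E UNIV) - zero_locus I F"
  then obtain F K where F: "F \<subseteq> poly_funs I" "S = (I \<rightarrow>\<^sub>E UNIV) - zero_locus I F"
    and K: "K \<subseteq> poly_funs I" "T = (I \<rightarrow>\<^sub>E UNIV) - zero_locus I K"
    by (elim exE conjE)
  define L where "L = (\<lambda>(f, g) x. f x * g x) ` (F \<times> K)"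
  have "L \<subseteq> poly_funs I"
    using F(1) K(1) by (auto simp: L_def intro!: poly_mult)
  moreover have "S \<inter> T = (I \<rightarrow>\<^sub>E UNIV) - zero_locus I L"
    unfolding F(2) K(2)
  proof (intro set_eqI)
    fix x :: "'a \<Rightarrow> real"
    have "(\<forall>h\<in>L. h x = 0) \<longleftrightarrow> (\<forall>f\<in>F. f x = 0) \<or> (\<forall>g\<in>K. g x = 0)"
      by (fastforce simp: L_def)
    then show "x \<in> ((I \<rightarrow>\<^sub>E UNIV) - zero_locus I F) \<inter> ((I \<rightarrow>\<^sub>E UNIV) - zero_locus I K)
      \<longleftrightarrow> x \<in> (I \<rightarrow>\<^sub>E UNIV) - zero_locus I L"
      unfolding zero_locus_def Int_iff Diff_iff mem_Collect_eq by argo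
  qed
  ultimately show "\<exists>F \<subseteq> poly_funs I. S \<inter> T = (I \<rightarrow>\<^sub>E UNIV) - zero_locus I F"
    by (intro exI conjI)
next
  fix \<K> :: "('a \<Rightarrow> real) set set"
  assume *: "\<forall>U\<in>\<K>. \<exists>F \<subseteq> poly_funs I. U = (I \<rightarrow>\<^sub>E UNIV) - zero_locus I F"
  from bchoice [OF *] obtain F
    where F0: "\<forall>U\<in>\<K>. F U \<subseteq> poly_funs I \<and> U = (I \<rightarrow>\<^sub>E UNIV) - zero_locus I (F U)" ..
  have F: "F U \<subseteq> poly_funs I" "U = (I \<rightarrow>\<^sub>E UNIV) - zero_locus I (F U)" if "U \<in> \<K>" for U
    using bspec [OF F0 that] by simp_all
  have "(\<Union>U\<in>\<K>. U) = (\<Union>U\<in>\<K>. (I \<rightarrow>\<^sub>E UNIV) - zero_locus I (F U))"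
    by (rule SUP_cong [OF refl F(2)])
  also have "\<dots> = (I \<rightarrow>\<^sub>E UNIV) - zero_locus I (\<Union>U\<in>\<K>. F U)"
    unfolding zero_locus_def set_eq_iff UN_iff Diff_iff mem_Collect_eq by blast
  finally have "\<Union>\<K> = (I \<rightarrow>\<^sub>E UNIV) - zero_locus I (\<Union>U\<in>\<K>. F U)"
    unfolding image_ident .
  moreover have "(\<Union>U\<in>\<K>. F U) \<subseteq> poly_funs I"
    using F(1) by (rule UN_least)
  ultimately show "\<exists>F \<subseteq> poly_funs I. \<Union>\<K> = (I \<rightarrow>\<^sub>E UNIV) - zero_locus I F"
    by (intro exI conjI)
qed

lemma openin_zariski:
  "openin (zariski_topology I) U \<longleftrightarrow> (\<exists>F \<subseteq> poly_funs I. U = (I \<rightarrow>\<^sub>E UNIV) - zero_locus I F)"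
  by (simp add: zariski_topology_def topology_inverse' [OF istopology_zariski])

lemma zero_locus_subset: "zero_locus I F \<subseteq> (I \<rightarrow>\<^sub>E UNIV)"
  unfolding zero_locus_def by (rule Collect_restrict)

lemma topspace_zariski [simp]: "topspace (zariski_topology I) = I \<rightarrow>\<^sub>E UNIV"
proof (rule antisym)
  have "zero_locus I {\<lambda>x. 1} = {}"
    by (simp add: zero_locus_def)
  then have "(I \<rightarrow>\<^sub>E UNIV) = (I \<rightarrow>\<^sub>E UNIV) - zero_locus I {\<lambda>x. 1}"
    by simp
  moreover have "{\<lambda>x. 1} \<subseteq> poly_funs I"
    using poly_const [of 1 I] by simp
  ultimately have "openin (zariski_topology I) (I \<rightarrow>\<^sub>E UNIV)"
    unfolding openin_zariski by (intro exI conjI)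
  then show "(I \<rightarrow>\<^sub>E UNIV) \<subseteq> topspace (zariski_topology I)"
    by (rule openin_subset)
next
  obtain F where "topspace (zariski_topology I) = (I \<rightarrow>\<^sub>E UNIV) - zero_locus I F"
    using openin_topspace [of "zariski_topology I"] unfolding openin_zariski by (elim exE conjE)
  then show "topspace (zariski_topology I) \<subseteq> (I \<rightarrow>\<^sub>E UNIV)"
    by simp
qed

lemma closedin_zariski:
  "closedin (zariski_topology I) Z \<longleftrightarrow> (\<exists>F \<subseteq> poly_funs I. Z = zero_locus I F)"
proof
  assume "closedin (zariski_topology I) Z"
  then have Z: "Z \<subseteq> (I \<rightarrow>\<^sub>E UNIV)" and "openin (zariski_topology I) ((I \<rightarrow>\<^sub>E UNIV) - Z)"
    by (simp_all add: closedin_def)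
  then obtain F where F: "F \<subseteq> poly_funs I" "(I \<rightarrow>\<^sub>E UNIV) - Z = (I \<rightarrow>\<^sub>E UNIV) - zero_locus I F"
    unfolding openin_zariski by (elim exE conjE)
  have "Z = (I \<rightarrow>\<^sub>E UNIV) - ((I \<rightarrow>\<^sub>E UNIV) - Z)"
    by (rule double_diff [OF Z order_refl, symmetric])
  also have "\<dots> = zero_locus I F"
    unfolding F(2) by (rule double_diff [OF zero_locus_subset order_refl])
  finally have "Z = zero_locus I F" .
  with F(1) show "\<exists>F \<subseteq> poly_funs I. Z = zero_locus I F"
    by (intro exI conjI)
next
  assume "\<exists>F \<subseteq> poly_funs I. Z = zero_locus I F"
  then obtain F where F: "F \<subseteq> poly_funs I" "Z = zero_locus I F"
    by (elim exE conjE)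
  then have "openin (zariski_topology I) ((I \<rightarrow>\<^sub>E UNIV) - Z)"
    unfolding openin_zariski by (intro exI conjI) simp_all
  then show "closedin (zariski_topology I) Z"
    by (simp add: closedin_def F(2) zero_locus_subset)
qed

definition irreducible_in :: "'a topology \<Rightarrow> 'a set \<Rightarrow> bool" where
  "irreducible_in X Z \<longleftrightarrow> Z \<noteq> {} \<and> Z \<subseteq> topspace X \<and>
     (\<forall>A B. closedin X A \<and> closedin X B \<and> Z \<subseteq> A \<union> B \<longrightarrow> Z \<subseteq> A \<or> Z \<subseteq> B)"

text \<open>
  Supremum of the lengths \<open>n\<close> of chains \<open>Z\<^sub>0 \<subset> \<dots> \<subset> Z\<^sub>n\<close> of irreducible closed subsets.
  In \<^typ>\<open>ereal\<close> the supremum of the empty set is \<open>-\<infinity>\<close>, so the empty space has dimension \<open>-\<infinity>\<close>.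
\<close>
definition krull_dim :: "'a topology \<Rightarrow> ereal" where
  "krull_dim X = Sup {ereal (real n) | n. \<exists>Z :: nat \<Rightarrow> 'a set.
     (\<forall>i\<le>n. closedin X (Z i) \<and> irreducible_in X (Z i)) \<and> (\<forall>i<n. Z i \<subset> Z (Suc i))}"

definition variety_dim :: "'v set \<Rightarrow> ('v \<Rightarrow> real) set \<Rightarrow> ereal" where
  "variety_dim I V = krull_dim (subtopology (zariski_topology I) V)"


section \<open>Directed trees, treks and the constant colouring\<close>

text \<open>
  The predicate \<^const>\<open>tree\<close> only excludes directed cycles, and in the symmetric digraph
  \<^term>\<open>mk_symmetric G\<close> every edge yields a cycle of length 2. Given that \<^term>\<open>G\<close> has no
  directed cycles, the underlying undirected graph is simple and its cycles are exactly the cycles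
  of \<^term>\<open>mk_symmetric G\<close> of length at least 3.
\<close>
definition directed_tree :: "nat \<Rightarrow> nat pair_pre_digraph \<Rightarrow> bool" where
  "directed_tree m G \<longleftrightarrow>
     pair_digraph G \<and> pverts G = {1..m} \<and>
     forest (with_proj G) \<and>
     Digraph_Component.connected (with_proj G) \<and>
     \<not> (\<exists>p. pre_digraph.cycle (with_proj (mk_symmetric (with_proj G))) p \<and> 3 \<le> length p) \<and>
     (\<exists>!s. s \<in> pverts G \<and> in_degree (with_proj G) s = 0)"

definition treks ::
    "nat pair_pre_digraph \<Rightarrow> nat \<Rightarrow> nat \<Rightarrow> ((nat \<times> nat) awalk \<times> (nat \<times> nat) awalk) set" where
  "treks G i j =
     {(P, Q). \<exists>k. pre_digraph.apath (with_proj G) k P i \<and> pre_digraph.apath (with_proj G) k Q j}"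

definition trek_poly :: "nat pair_pre_digraph \<Rightarrow> nat \<Rightarrow> nat \<Rightarrow> real \<Rightarrow> real \<Rightarrow> real" where
  "trek_poly G i j \<omega> l = (\<Sum>(P, Q)\<in>treks G i j. \<omega> * l ^ (length P + length Q))"

definition cov_coords :: "nat \<Rightarrow> (nat \<times> nat) set" where
  "cov_coords m = {(i, j). 1 \<le> i \<and> i \<le> j \<and> j \<le> m}"

definition trek_map :: "nat \<Rightarrow> nat pair_pre_digraph \<Rightarrow> real \<times> real \<Rightarrow> (nat \<times> nat \<Rightarrow> real)" where
  "trek_map m G = (\<lambda>(\<omega>, l). \<lambda>(i, j)\<in>cov_coords m. trek_poly G i j \<omega> l)"

definition tree_model :: "nat \<Rightarrow> nat pair_pre_digraph \<Rightarrow> (nat \<times> nat \<Rightarrow> real) set" where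
  "tree_model m G = trek_map m G ` ({0..} \<times> UNIV)"

definition tree_variety :: "nat \<Rightarrow> nat pair_pre_digraph \<Rightarrow> (nat \<times> nat \<Rightarrow> real) set" where
  "tree_variety m G = zariski_topology (cov_coords m) closure_of (tree_model m G)"

end

theory Submission
  imports Defs "HOL-Computational_Algebra.Polynomial"
begin

text \<open>
  Let \<open>s\<close> be the root of \<open>H\<close>. For every arc \<open>i \<rightarrow> j\<close> of \<open>H\<close> the equation
  \<open>p\<^sub>i\<^sub>i p\<^sub>j\<^sub>j - p\<^sub>i\<^sub>j\<^sup>2 = p\<^sub>s\<^sub>s p\<^sub>i\<^sub>i\<close> holds on the variety of \<open>H\<close>. If that variety contains the
  variety of \<open>G\<close>, the equation holds for the trek polynomials of \<open>G\<close> at \<open>\<omega> = 1\<close>. There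
  \<open>p\<^sub>i\<^sub>j > 0\<close> for \<open>\<lambda> > 0\<close>, so \<open>p\<^sub>j\<^sub>j > p\<^sub>s\<^sub>s\<close> for all \<open>j \<noteq> s\<close>, which forces \<open>s\<close> to be the root of
  \<open>G\<close> too. Then \<open>p\<^sub>i\<^sub>j\<close> has order 1 in \<open>\<lambda>\<close> at 0, so \<open>i\<close> and \<open>j\<close> are adjacent in \<open>G\<close>, and
  \<open>\<lambda> = 1\<close> rules out the arc \<open>j \<rightarrow> i\<close>. Hence \<open>H\<close> and \<open>G\<close> have the same arcs.

  So for \<open>G \<noteq> H\<close> the intersection is a proper closed subset of each of the two irreducible
  varieties. It has smaller dimension because the dimensions are at most 2: a chain
  \<open>Z\<^sub>0 \<subset> Z\<^sub>1 \<subset> Z\<^sub>2 \<subset> Z\<^sub>3\<close> yields three algebraically independent polynomial functions, vanishing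
  on \<open>Z\<^sub>k\<close> but not on \<open>Z\<^sub>k\<^sub>+\<^sub>1\<close>, whereas three polynomials in \<open>\<omega>, \<lambda>\<close> are dependent.
\<close>

section \<open>Polynomial functions in two variables\<close>

text \<open>The outer variable is \<omega>, and the coefficients are polynomials in \<lambda>. This
  ring is an integral domain; \<omega> is inserted as the constant polynomial
  \<open>[:\<omega>:]\<close>.\<close>

definition eval2 :: "real poly poly \<Rightarrow> real \<Rightarrow> real \<Rightarrow> real" where
  "eval2 Q \<omega> l = poly (poly Q [:\<omega>:]) l"

lemma eval2_0 [simp]: "eval2 0 \<omega> l = 0"
  by (simp add: eval2_def)

lemma eval2_1 [simp]: "eval2 1 \<omega> l = 1"
  by (simp add: eval2_def)

lemma eval2_const [simp]: "eval2 [:[:c:]:] \<omega> l = c"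
  by (simp add: eval2_def)

lemma eval2_add [simp]: "eval2 (P + Q) \<omega> l = eval2 P \<omega> l + eval2 Q \<omega> l"
  by (simp add: eval2_def)

lemma eval2_mult [simp]: "eval2 (P * Q) \<omega> l = eval2 P \<omega> l * eval2 Q \<omega> l"
  by (simp add: eval2_def)

lemma eval2_power [simp]: "eval2 (P ^ n) \<omega> l = eval2 P \<omega> l ^ n"
  by (induction n) simp_all

lemma eval2_smult [simp]: "eval2 (smult [:c:] P) \<omega> l = c * eval2 P \<omega> l"
  by (simp add: eval2_def)

lemma eval2_sum [simp]: "eval2 (sum Q A) \<omega> l = (\<Sum>a\<in>A. eval2 (Q a) \<omega> l)"
  by (induction A rule: infinite_finite_induct) simp_all

text \<open>Fixing \<omega> leaves a polynomial in \<lambda> that vanishes everywhere, so all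
  \<open>[:\<omega>:]\<close> with \<omega> \<ge> 0 are roots of \<open>Q\<close>, too many for a
  nonzero \<open>Q\<close>. Polynomial identities can thus be tested on the parameters of the
  model.\<close>

lemma eval2_eq_0_imp:
  assumes "\<And>\<omega> l. \<omega> \<ge> 0 \<Longrightarrow> eval2 Q \<omega> l = 0"
  shows "Q = 0"
proof (rule ccontr)
  assume "Q \<noteq> 0"
  then have fin: "finite {p. poly Q p = 0}"
    by (rule poly_roots_finite)
  have "poly Q [:\<omega>:] = 0" if "\<omega> \<ge> 0" for \<omega>
    using assms [OF that] poly_all_0_iff_0 [of "poly Q [:\<omega>:]"] by (simp add: eval2_def)
  then have "(\<lambda>\<omega>. [:\<omega>:]) ` {0..} \<subseteq> {p. poly Q p = 0}"
    by auto
  then have "finite ((\<lambda>\<omega>::real. [:\<omega>:]) ` {0..})"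
    using fin by (rule finite_subset)
  then have "finite {0::real..}"
    by (rule finite_imageD) (simp add: inj_on_def)
  then show False
    using infinite_Ici by blast
qed

section \<open>Bidegrees and algebraic dependence\<close>

definition bidegree_le :: "nat \<Rightarrow> 'a::comm_ring_1 poly poly \<Rightarrow> bool" where
  "bidegree_le d Q \<longleftrightarrow> degree Q \<le> d \<and> (\<forall>i. degree (coeff Q i) \<le> d)"

lemma bidegree_le_ex: "\<exists>d. bidegree_le d Q"
proof -
  define d where "d = degree Q + (\<Sum>i\<le>degree Q. degree (coeff Q i))"
  have "degree (coeff Q i) \<le> d" for i
  proof (cases "i \<le> degree Q")
    case True
    then have "degree (coeff Q i) \<le> (\<Sum>i\<le>degree Q. degree (coeff Q i))"
      by (intro member_le_sum) auto
    then show ?thesis by (simp add: d_def)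
  next
    case False
    then show ?thesis by (simp add: coeff_eq_0)
  qed
  then show ?thesis
    unfolding bidegree_le_def by (intro exI [of _ d]) (simp add: d_def)
qed

lemma bidegree_le_mono: "bidegree_le d Q \<Longrightarrow> d \<le> e \<Longrightarrow> bidegree_le e Q"
  unfolding bidegree_le_def using le_trans by blast

lemma bidegree_le_1: "bidegree_le 0 1"
  by (simp add: bidegree_le_def)

lemma bidegree_le_mult:
  assumes "bidegree_le d P" "bidegree_le e Q"
  shows "bidegree_le (d + e) (P * Q)"
  unfolding bidegree_le_def
proof (intro conjI allI)
  show "degree (P * Q) \<le> d + e"
    using assms degree_mult_le [of P Q] by (auto simp: bidegree_le_def intro: order_trans add_mono)
next
  fix i
  have "degree (coeff P j * coeff Q (i - j)) \<le> d + e" for j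
    using assms degree_mult_le [of "coeff P j" "coeff Q (i - j)"]
    by (meson add_mono bidegree_le_def order_trans)
  then show "degree (coeff (P * Q) i) \<le> d + e"
    unfolding coeff_mult by (intro degree_sum_le) simp_all
qed

lemma bidegree_le_power:
  assumes "bidegree_le d P"
  shows "bidegree_le (n * d) (P ^ n)"
proof (induction n)
  case 0
  then show ?case by (simp add: bidegree_le_1)
next
  case (Suc n)
  show ?case using bidegree_le_mult [OF assms Suc.IH] by simp
qed

text \<open>Gaussian elimination, one equation per induction step: equation \<open>j\<close> is
  either trivial or solved for one unknown, which leaves one equation and one unknown fewer.\<close>

lemma homogeneous_system_nontrivial_solution:
  fixes M :: "'a \<Rightarrow> 'b \<Rightarrow> 'c::field"
  assumes "finite J" "finite A" "card J < card A"
  shows "\<exists>c. (\<exists>a\<in>A. c a \<noteq> 0) \<and> (\<forall>j\<in>J. (\<Sum>a\<in>A. c a * M a j) = 0)"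
  using assms
proof (induction J arbitrary: A M rule: finite_induct)
  case empty
  then have "A \<noteq> {}" by auto
  then show ?case by (intro exI [of _ "\<lambda>_. 1"]) auto
next
  case (insert j J)
  show ?case
  proof (cases "\<forall>a\<in>A. M a j = 0")
    case True
    have "card J < card A" using insert by simp
    then obtain c where "\<exists>a\<in>A. c a \<noteq> 0" "\<forall>j\<in>J. (\<Sum>a\<in>A. c a * M a j) = 0"
      using insert.IH [OF \<open>finite A\<close>] by blast
    moreover have "(\<Sum>a\<in>A. c a * M a j) = 0"
      using True by (intro sum.neutral) simp
    ultimately show ?thesis by (intro exI [of _ c]) simp
  next
    case False
    then obtain a0 where a0: "a0 \<in> A" "M a0 j \<noteq> 0" by blast
    define M' where "M' a k = M a k - M a j / M a0 j * M a0 k" for a k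
    have "card J < card (A - {a0})" using insert a0 by simp
    then obtain c where c: "\<exists>a\<in>A - {a0}. c a \<noteq> 0"
      "\<And>k. k \<in> J \<Longrightarrow> (\<Sum>a\<in>A - {a0}. c a * M' a k) = 0"
      using insert.IH [of "A - {a0}" M'] \<open>finite A\<close> by blast
    \<comment> \<open>The value that equation \<open>j\<close> forces on the pivot unknown
      \<open>a0\<close>.\<close>
    define t where "t = - (\<Sum>a\<in>A - {a0}. c a * M a j) / M a0 j"
    define c' where "c' = c(a0 := t)"
    have *: "(\<Sum>a\<in>A. c' a * M a k) = (\<Sum>a\<in>A - {a0}. c a * M' a k)" for k
    proof -
      have "(\<Sum>a\<in>A. c' a * M a k) = t * M a0 k + (\<Sum>a\<in>A - {a0}. c a * M a k)"
        using a0 \<open>finite A\<close> by (simp add: sum.remove c'_def)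
      also have "t * M a0 k = - (\<Sum>a\<in>A - {a0}. c a * (M a j / M a0 j * M a0 k))"
        by (simp add: t_def sum_distrib_right sum_divide_distrib sum_negf mult.assoc)
      finally show ?thesis
        by (simp add: M'_def right_diff_distrib sum_subtractf)
    qed
    have "\<exists>a\<in>A. c' a \<noteq> 0"
      using c(1) by (auto simp: c'_def)
    moreover have "(\<Sum>a\<in>A. c' a * M a k) = 0" if "k \<in> insert j J" for k
    proof (cases "k = j")
      case True
      then show ?thesis using a0 by (simp add: * M'_def)
    next
      case False
      then show ?thesis using that c(2) by (simp add: *)
    qed
    ultimately show ?thesis by blast
  qed
qed

text \<open>
  With \<open>D\<close> bounding the bidegrees, the \<open>(N + 1)\<^sup>3\<close> monomials with exponents at most \<open>N\<close> have
  bidegree at most \<open>3 N D\<close>, hence lie in a space of dimension \<open>(3 N D + 1)\<^sup>2\<close>, which is smaller for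
  \<open>N = (3 D + 1)\<^sup>2\<close>.
\<close>
lemma three_bivariate_polys_dependent:
  fixes P Q R :: "real poly poly"
  shows "\<exists>N c. (\<exists>i\<le>N. \<exists>j\<le>N. \<exists>k\<le>N. c i j k \<noteq> 0) \<and>
    (\<Sum>k\<le>N. (\<Sum>j\<le>N. (\<Sum>i\<le>N. smult [:c i j k:] (P ^ i)) * Q ^ j) * R ^ k) = 0"
proof -
  obtain d1 d2 d3 where "bidegree_le d1 P" "bidegree_le d2 Q" "bidegree_le d3 R"
    using bidegree_le_ex by metis
  moreover define D where "D = d1 + d2 + d3"
  ultimately have D: "bidegree_le D P" "bidegree_le D Q" "bidegree_le D R"
    by (auto elim: bidegree_le_mono)
  define N where "N = (3 * D + 1)\<^sup>2"
  define B where "B = 3 * N * D"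
  define A where "A = {..N} \<times> {..N} \<times> {..N}"
  define mon where "mon = (\<lambda>(i, j, k). P ^ i * Q ^ j * R ^ k)"
  have "(B + 1)\<^sup>2 \<le> ((3 * D + 1) * (N + 1))\<^sup>2"
    by (intro power_mono) (simp_all add: B_def algebra_simps)
  also have "\<dots> = N * (N + 1)\<^sup>2"
    unfolding power_mult_distrib N_def ..
  also have "\<dots> < (N + 1) * (N + 1)\<^sup>2"
    by simp
  finally have "card ({..B} \<times> {..B}) < card A"
    by (simp add: A_def card_cartesian_product power2_eq_square mult.assoc)
  then obtain c where c: "\<exists>a\<in>A. c a \<noteq> (0::real)"
    "\<And>u v. u \<le> B \<Longrightarrow> v \<le> B \<Longrightarrow> (\<Sum>a\<in>A. c a * coeff (coeff (mon a) u) v) = 0"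
    using homogeneous_system_nontrivial_solution
      [of "{..B} \<times> {..B}" A "\<lambda>a (u, v). coeff (coeff (mon a) u) v"]
    by (auto simp: A_def)
  have mon_le: "bidegree_le B (mon a)" if "a \<in> A" for a
  proof -
    from that obtain i j k where a: "a = (i, j, k)" "i \<le> N" "j \<le> N" "k \<le> N"
      by (auto simp: A_def)
    have "bidegree_le (i * D + j * D + k * D) (mon a)"
      unfolding a mon_def prod.case by (intro bidegree_le_mult bidegree_le_power D)
    moreover have "i * D + j * D + k * D \<le> B"
      using add_mono [OF add_mono [OF mult_right_mono [OF a(2)] mult_right_mono [OF a(3)]]
          mult_right_mono [OF a(4)], of D D D]
      by (simp add: B_def)
    ultimately show ?thesis by (rule bidegree_le_mono)
  qed
  have "(\<Sum>a\<in>A. smult [:c a:] (mon a)) = 0"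
  proof (rule poly_eqI, rule poly_eqI)
    fix u v
    \<comment> \<open>\<open>c\<close> settles the coefficients with both indices at most
      \<open>B\<close>; the bidegree bound settles all others.\<close>
    have "coeff (coeff (mon a) u) v = 0" if "a \<in> A" "\<not> (u \<le> B \<and> v \<le> B)" for a
    proof (cases "u \<le> B")
      case True
      then have "degree (coeff (mon a) u) < v"
        using mon_le [OF that(1)] that(2) by (auto simp: bidegree_le_def intro: le_less_trans)
      then show ?thesis by (rule coeff_eq_0)
    next
      case False
      then have "degree (mon a) < u"
        using mon_le [OF that(1)] by (auto simp: bidegree_le_def)
      then show ?thesis by (simp add: coeff_eq_0)
    qed
    then have "(\<Sum>a\<in>A. c a * coeff (coeff (mon a) u) v) = 0"
      using c(2) [of u v] by (cases "u \<le> B \<and> v \<le> B") auto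
    then show "coeff (coeff (\<Sum>a\<in>A. smult [:c a:] (mon a)) u) v = coeff (coeff 0 u) v"
      by (simp add: coeff_sum)
  qed
  \<comment> \<open>Regrouped as a polynomial in \<open>R\<close> over polynomials in
    \<open>Q\<close> over polynomials in \<open>P\<close>, the shape that
    \<open>no_long_chain\<close> peels layer by layer.\<close>
  moreover have "(\<Sum>a\<in>A. smult [:c a:] (mon a)) =
      (\<Sum>k\<le>N. (\<Sum>j\<le>N. (\<Sum>i\<le>N. smult [:c (i, j, k):] (P ^ i)) * Q ^ j) * R ^ k)"
  proof -
    have "(\<Sum>a\<in>A. smult [:c a:] (mon a)) = (\<Sum>i\<le>N. \<Sum>j\<le>N. \<Sum>k\<le>N. smult [:c (i, j, k):] (mon (i, j, k)))"
      by (simp add: A_def sum.cartesian_product split_def)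
    also have "\<dots> = (\<Sum>i\<le>N. \<Sum>k\<le>N. \<Sum>j\<le>N. smult [:c (i, j, k):] (mon (i, j, k)))"
      by (rule sum.cong [OF refl sum.swap])
    also have "\<dots> = (\<Sum>k\<le>N. \<Sum>i\<le>N. \<Sum>j\<le>N. smult [:c (i, j, k):] (mon (i, j, k)))"
      by (rule sum.swap)
    also have "\<dots> = (\<Sum>k\<le>N. \<Sum>j\<le>N. \<Sum>i\<le>N. smult [:c (i, j, k):] (mon (i, j, k)))"
      by (rule sum.cong [OF refl sum.swap])
    finally show ?thesis
      by (simp add: mon_def sum_distrib_right)
  qed
  ultimately show ?thesis
    using c(1) by (intro exI [of _ N] exI [of _ "\<lambda>i j k. c (i, j, k)"]) (auto simp: A_def)
qed

section \<open>Irreducible closed sets and dimension\<close>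

lemma poly_funs_sum:
  "(\<And>a. a \<in> A \<Longrightarrow> f a \<in> poly_funs I) \<Longrightarrow> (\<lambda>x. \<Sum>a\<in>A. f a x) \<in> poly_funs I"
  by (induction A rule: infinite_finite_induct) (auto intro: poly_funs.intros)

lemma poly_funs_power: "f \<in> poly_funs I \<Longrightarrow> (\<lambda>x. f x ^ n) \<in> poly_funs I"
  by (induction n) (auto intro: poly_funs.intros)

lemma poly_funs_diff:
  assumes "f \<in> poly_funs I" "g \<in> poly_funs I"
  shows "(\<lambda>x. f x - g x) \<in> poly_funs I"
  using poly_funs.poly_add [OF assms(1) poly_funs.poly_mult [OF poly_funs.poly_const [of "-1"] assms(2)]] by simp

lemma closedin_zero_set:
  "f \<in> poly_funs I \<Longrightarrow> closedin (zariski_topology I) {x \<in> I \<rightarrow>\<^sub>E UNIV. f x = 0}"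
  unfolding closedin_zariski zero_locus_def by (intro exI [of _ "{f}"]) auto

lemma poly_fun_zero_on_closure:
  assumes "f \<in> poly_funs I" "\<And>x. x \<in> S \<Longrightarrow> f x = 0" "S \<subseteq> I \<rightarrow>\<^sub>E UNIV"
    and "x \<in> zariski_topology I closure_of S"
  shows "f x = 0"
  using closure_of_minimal [OF _ closedin_zero_set [OF assms(1)], of S] assms(2-4) by blast

text \<open>The two zero sets are closed and cover \<open>Z\<close>. In effect, the coordinate ring
  of \<open>Z\<close> has no zero divisors.\<close>

lemma irreducible_zero_product:
  assumes "irreducible_in (zariski_topology I) Z" "f \<in> poly_funs I" "g \<in> poly_funs I"
    and "\<And>x. x \<in> Z \<Longrightarrow> f x * g x = 0"
  shows "(\<forall>x\<in>Z. f x = 0) \<or> (\<forall>x\<in>Z. g x = 0)"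
proof -
  have "Z \<subseteq> {x \<in> I \<rightarrow>\<^sub>E UNIV. f x = 0} \<union> {x \<in> I \<rightarrow>\<^sub>E UNIV. g x = 0}"
    using assms(1,4) by (auto simp: irreducible_in_def)
  then show ?thesis
    using assms(1) closedin_zero_set [OF assms(2)] closedin_zero_set [OF assms(3)]
    unfolding irreducible_in_def by blast
qed

lemma closedin_separating:
  assumes "closedin (zariski_topology I) Z'" "Z \<subseteq> I \<rightarrow>\<^sub>E UNIV" "\<not> Z \<subseteq> Z'"
  obtains f where "f \<in> poly_funs I" "\<And>x. x \<in> Z' \<Longrightarrow> f x = 0" "\<exists>x\<in>Z. f x \<noteq> 0"
proof -
  obtain F where F: "F \<subseteq> poly_funs I" "Z' = zero_locus I F"
    using assms(1) by (auto simp: closedin_zariski)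
  obtain x where x: "x \<in> Z" "x \<notin> Z'" using assms(3) by blast
  then obtain f where "f \<in> F" "f x \<noteq> 0"
    using F assms(2) by (auto simp: zero_locus_def)
  then show thesis using F x by (intro that [of f]) (auto simp: zero_locus_def)
qed

text \<open>
  On \<open>Z\<close> one may cancel powers of \<open>f\<close>, and on \<open>Z'\<close> only the lowest remaining coefficient of the
  polynomial in \<open>f\<close> survives.
\<close>
lemma coefficients_zero_step:
  assumes irr: "irreducible_in (zariski_topology I) Z" and "Z' \<subseteq> Z"
    and f: "f \<in> poly_funs I" "\<And>x. x \<in> Z' \<Longrightarrow> f x = 0" "\<exists>x\<in>Z. f x \<noteq> 0"
    and g: "\<And>k. k \<le> N \<Longrightarrow> g k \<in> poly_funs I"
    and lift: "\<And>k. k \<le> N \<Longrightarrow> (\<And>x. x \<in> Z' \<Longrightarrow> g k x = 0) \<Longrightarrow> (\<And>x. g k x = 0)"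
    and zero: "\<And>x. x \<in> Z \<Longrightarrow> (\<Sum>k\<le>N. g k x * f x ^ k) = 0"
  shows "k \<le> N \<Longrightarrow> g k x = 0"
proof (induction k arbitrary: x rule: less_induct)
  case (less k)
  \<comment> \<open>What remains of the sum after division by \<open>f ^ k\<close>, the terms below
    \<open>k\<close> being zero by induction.\<close>
  define h where "h x = (\<Sum>i=k..N. g i x * f x ^ (i - k))" for x
  have h: "h \<in> poly_funs I"
    unfolding h_def by (intro poly_funs_sum poly_funs.poly_mult poly_funs_power f g) simp
  have "f x ^ k * h x = 0" if "x \<in> Z" for x
  proof -
    have "f x ^ k * h x = (\<Sum>i=k..N. g i x * f x ^ i)"
      unfolding h_def sum_distrib_left
    proof (intro sum.cong refl)
      fix i assume "i \<in> {k..N}"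
      then have "f x ^ i = f x ^ k * f x ^ (i - k)"
        by (simp flip: power_add)
      then show "f x ^ k * (g i x * f x ^ (i - k)) = g i x * f x ^ i"
        by simp
    qed
    also have "\<dots> = (\<Sum>i\<le>N. g i x * f x ^ i)"
      using less.IH by (intro sum.mono_neutral_left) auto
    finally show ?thesis using zero [OF that] by simp
  qed
  then have "\<forall>x\<in>Z. h x = 0"
    using irreducible_zero_product [OF irr poly_funs_power [OF f(1), of k] h] f(3) by auto
  \<comment> \<open>On \<open>Z'\<close> the function \<open>f\<close> is 0, and
    \<open>0 ^ (i - k)\<close> is nonzero only for \<open>i = k\<close>.\<close>
  moreover have "h x = g k x" if "x \<in> Z'" for x
  proof -
    have "h x = (\<Sum>i\<in>{k}. g i x * f x ^ (i - k))"
      unfolding h_def using less.prems f(2) [OF that] by (intro sum.mono_neutral_right) auto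
    then show ?thesis by simp
  qed
  ultimately have "g k x = 0" if "x \<in> Z'" for x
    using that \<open>Z' \<subseteq> Z\<close> by force
  then show ?case by (rule lift [OF less.prems])
qed

section \<open>Closures of images of polynomial maps in two parameters\<close>

locale polynomial_parametrization =
  fixes I :: "'v set" and \<phi> :: "real \<times> real \<Rightarrow> 'v \<Rightarrow> real"
  assumes extensional: "\<phi> z \<in> I \<rightarrow>\<^sub>E UNIV"
    and coordinate: "i \<in> I \<Longrightarrow> \<exists>Q. \<forall>\<omega> l. \<phi> (\<omega>, l) i = eval2 Q \<omega> l"
begin

definition image_closure :: "('v \<Rightarrow> real) set" where
  "image_closure = zariski_topology I closure_of (\<phi> ` ({0..} \<times> UNIV))"

lemma pullback: "f \<in> poly_funs I \<Longrightarrow> \<exists>Q. \<forall>\<omega> l. f (\<phi> (\<omega>, l)) = eval2 Q \<omega> l"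
proof (induction rule: poly_funs.induct)
  case (poly_const c)
  show ?case by (intro exI [of _ "[:[:c:]:]"]) simp
next
  case (poly_coord i)
  then show ?case by (rule coordinate)
next
  case (poly_add f g)
  then show ?case by (metis eval2_add)
next
  case (poly_mult f g)
  then show ?case by (metis eval2_mult)
qed

lemma image_subset: "\<phi> ` S \<subseteq> I \<rightarrow>\<^sub>E UNIV"
  using extensional by blast

lemma image_subset_closure: "\<phi> ` ({0..} \<times> UNIV) \<subseteq> image_closure"
  unfolding image_closure_def using image_subset by (intro closure_of_subset) simp

lemma closedin_image_closure: "closedin (zariski_topology I) image_closure"
  by (simp add: image_closure_def)

lemma zero_on_image_closure:
  assumes "f \<in> poly_funs I" "\<And>\<omega> l. \<omega> \<ge> 0 \<Longrightarrow> f (\<phi> (\<omega>, l)) = 0" "x \<in> image_closure"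
  shows "f x = 0"
  using assms(3) unfolding image_closure_def
  by (rule poly_fun_zero_on_closure [OF assms(1), rotated 2])
     (use assms(2) image_subset in auto)

text \<open>If neither closed set contains the closure, each is separated from the image by a
  polynomial function. Both functions pull back to nonzero polynomials, but their product pulls back
  to 0.\<close>

lemma irreducible_image_closure: "irreducible_in (zariski_topology I) image_closure"
  unfolding irreducible_in_def
proof (intro conjI allI impI)
  show "image_closure \<noteq> {}"
    using image_subset_closure by force
  show "image_closure \<subseteq> topspace (zariski_topology I)"
    using closedin_image_closure by (rule closedin_subset)
next
  fix A B
  assume AB: "closedin (zariski_topology I) A \<and> closedin (zariski_topology I) B \<and>
    image_closure \<subseteq> A \<union> B"
  let ?S = "\<phi> ` ({0..} \<times> UNIV)"
  have min: "image_closure \<subseteq> C" if "closedin (zariski_topology I) C" "?S \<subseteq> C" for C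
    unfolding image_closure_def using that by (intro closure_of_minimal)
  show "image_closure \<subseteq> A \<or> image_closure \<subseteq> B"
  proof (rule ccontr)
    assume "\<not> ?thesis"
    then have "\<not> ?S \<subseteq> A" "\<not> ?S \<subseteq> B" using min AB by blast+
    obtain f where f: "f \<in> poly_funs I" "\<And>x. x \<in> A \<Longrightarrow> f x = 0" "\<exists>x\<in>?S. f x \<noteq> 0"
      using closedin_separating [OF _ image_subset \<open>\<not> ?S \<subseteq> A\<close>] AB by blast
    obtain g where g: "g \<in> poly_funs I" "\<And>x. x \<in> B \<Longrightarrow> g x = 0" "\<exists>x\<in>?S. g x \<noteq> 0"
      using closedin_separating [OF _ image_subset \<open>\<not> ?S \<subseteq> B\<close>] AB by blast
    obtain P where P: "\<And>\<omega> l. f (\<phi> (\<omega>, l)) = eval2 P \<omega> l" using pullback [OF f(1)] by blast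
    obtain Q where Q: "\<And>\<omega> l. g (\<phi> (\<omega>, l)) = eval2 Q \<omega> l" using pullback [OF g(1)] by blast
    have "eval2 (P * Q) \<omega> l = 0" if "\<omega> \<ge> 0" for \<omega> l
    proof -
      have "\<phi> (\<omega>, l) \<in> A \<union> B"
        using AB image_subset_closure that by blast
      then show ?thesis using f(2) g(2) by (auto simp flip: P Q)
    qed
    then have "P * Q = 0" by (rule eval2_eq_0_imp)
    then have "P = 0 \<or> Q = 0" by simp
    then show False using f(3) g(3) P Q by auto
  qed
qed

text \<open>The separating functions \<open>f 0\<close>, \<open>f 1\<close>, \<open>f 2\<close> of
  consecutive members pull back to dependent polynomials. The dependence holds on
  \<open>Z 3\<close>; peeling off \<open>f 2\<close>, \<open>f 1\<close>, \<open>f 0\<close> in turn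
  descends to \<open>Z 0\<close> and kills all its coefficients.\<close>

lemma no_long_chain:
  assumes closed: "\<And>i. i \<le> 3 \<Longrightarrow> closedin (zariski_topology I) (Z i)"
    and irr: "\<And>i. i \<le> 3 \<Longrightarrow> irreducible_in (zariski_topology I) (Z i)"
    and strict: "\<And>i. i < 3 \<Longrightarrow> Z i \<subset> Z (Suc i)"
    and sub: "Z (3::nat) \<subseteq> image_closure"
  shows False
proof -
  have "\<exists>f. f \<in> poly_funs I \<and> (\<forall>x\<in>Z i. f x = 0) \<and> (\<exists>x\<in>Z (Suc i). f x \<noteq> 0)" if "i < 3" for i
  proof -
    have "Z (Suc i) \<subseteq> I \<rightarrow>\<^sub>E UNIV" "\<not> Z (Suc i) \<subseteq> Z i"
      using closedin_subset [OF closed, of "Suc i"] that strict [OF that] by auto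
    then show ?thesis
      using closedin_separating [OF closed [of i]] that by (metis less_imp_le)
  qed
  then obtain f where f: "\<And>i. i < 3 \<Longrightarrow> f i \<in> poly_funs I"
    "\<And>i x. i < 3 \<Longrightarrow> x \<in> Z i \<Longrightarrow> f i x = 0" "\<And>i. i < 3 \<Longrightarrow> \<exists>x\<in>Z (Suc i). f i x \<noteq> 0"
    by metis
  have "\<exists>Q. \<forall>\<omega> l. f i (\<phi> (\<omega>, l)) = eval2 Q \<omega> l" if "i < 3" for i
    using pullback [OF f(1) [OF that]] .
  then obtain Q where Q: "\<And>i \<omega> l. i < 3 \<Longrightarrow> f i (\<phi> (\<omega>, l)) = eval2 (Q i) \<omega> l"
    by metis
  obtain N c where c: "\<exists>i\<le>N. \<exists>j\<le>N. \<exists>k\<le>N. c i j k \<noteq> 0"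
    "(\<Sum>k\<le>N. (\<Sum>j\<le>N. (\<Sum>i\<le>N. smult [:c i j k:] (Q 0 ^ i)) * Q 1 ^ j) * Q 2 ^ k) = 0"
    using three_bivariate_polys_dependent [of "Q 0" "Q 1" "Q 2"] by blast
  define g where "g j k x = (\<Sum>i\<le>N. c i j k * f 0 x ^ i)" for j k x
  define h where "h k x = (\<Sum>j\<le>N. g j k x * f 1 x ^ j)" for k x
  have g: "g j k \<in> poly_funs I" for j k
    unfolding g_def by (intro poly_funs_sum poly_funs.poly_mult poly_funs.poly_const poly_funs_power f(1)) simp
  have h: "h k \<in> poly_funs I" for k
    unfolding h_def by (intro poly_funs_sum poly_funs.poly_mult poly_funs_power f(1) g) simp
  have zero: "(\<Sum>k\<le>N. h k x * f 2 x ^ k) = 0" if "x \<in> Z 3" for x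
  proof (rule zero_on_image_closure [where f = "\<lambda>x. \<Sum>k\<le>N. h k x * f 2 x ^ k"])
    show "(\<lambda>x. \<Sum>k\<le>N. h k x * f 2 x ^ k) \<in> poly_funs I"
      by (intro poly_funs_sum poly_funs.poly_mult poly_funs_power f(1) h) simp
    show "(\<Sum>k\<le>N. h k (\<phi> (\<omega>, l)) * f 2 (\<phi> (\<omega>, l)) ^ k) = 0" for \<omega> l
      using arg_cong [OF c(2), of "\<lambda>P. eval2 P \<omega> l"] by (simp add: h_def g_def Q)
    show "x \<in> image_closure" using that sub by blast
  qed
  \<comment> \<open>The descent is proved from the bottom up, because each level supplies the
    \<open>lift\<close> premise of the next.\<close>
  have c0: "c i j k = 0" if "i \<le> N" "\<And>x. x \<in> Z 1 \<Longrightarrow> g j k x = 0" for i j k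
  proof (rule coefficients_zero_step [of I "Z 1" "Z 0" "f 0" N "\<lambda>i x. c i j k"])
    \<comment> \<open>A constant that vanishes on the nonempty set \<open>Z 0\<close> is 0.\<close>
    show "c i j k = 0" if "\<And>x. x \<in> Z 0 \<Longrightarrow> c i j k = 0" for i
      using irr [of 0] that by (auto simp: irreducible_in_def)
  qed (use irr f strict [of 0] that in \<open>auto simp: g_def intro: poly_funs.poly_const\<close>)
  have g0: "g j k x = 0" if "j \<le> N" "\<And>x. x \<in> Z 2 \<Longrightarrow> h k x = 0" for j k x
  proof (rule coefficients_zero_step [of I "Z 2" "Z 1" "f 1" N "\<lambda>j. g j k"])
    show "g j k x = 0" if "\<And>x. x \<in> Z 1 \<Longrightarrow> g j k x = 0" for j x
      using c0 [OF _ that] by (simp add: g_def)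
  qed (use irr f f(3) [of 1] strict [of 1] g that in \<open>auto simp: h_def numeral_2_eq_2\<close>)
  have h0: "h k x = 0" if "k \<le> N" for k x
  proof (rule coefficients_zero_step [of I "Z 3" "Z 2" "f 2" N h])
    show "h k x = 0" if "\<And>x. x \<in> Z 2 \<Longrightarrow> h k x = 0" for k x
      using g0 [OF _ that] by (simp add: h_def)
  qed (use irr f f(3) [of 2] strict [of 2] h zero that in \<open>auto simp: numeral_3_eq_3 numeral_2_eq_2\<close>)
  have "c i j k = 0" if "i \<le> N" "j \<le> N" "k \<le> N" for i j k
    using h0 [OF \<open>k \<le> N\<close>] by (intro c0 [OF \<open>i \<le> N\<close>] g0 [OF \<open>j \<le> N\<close>])
  then show False using c(1) by blast
qed

end

section \<open>Dimension of closed subspaces\<close>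

lemma irreducible_in_subtopology:
  assumes "Z \<subseteq> V"
  shows "irreducible_in (subtopology X V) Z \<longleftrightarrow> irreducible_in X Z"
proof -
  have "(\<forall>A B. closedin (subtopology X V) A \<and> closedin (subtopology X V) B \<and> Z \<subseteq> A \<union> B
          \<longrightarrow> Z \<subseteq> A \<or> Z \<subseteq> B)
    \<longleftrightarrow> (\<forall>A B. closedin X A \<and> closedin X B \<and> Z \<subseteq> A \<union> B \<longrightarrow> Z \<subseteq> A \<or> Z \<subseteq> B)" (is "?L \<longleftrightarrow> ?R")
  proof
    assume L: ?L
    show ?R
    proof (intro allI impI)
      fix A B assume AB: "closedin X A \<and> closedin X B \<and> Z \<subseteq> A \<union> B"
      then have "closedin (subtopology X V) (A \<inter> V)" "closedin (subtopology X V) (B \<inter> V)"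
        by (auto simp: closedin_subtopology)
      moreover have "Z \<subseteq> (A \<inter> V) \<union> (B \<inter> V)" using AB assms by blast
      ultimately have "Z \<subseteq> A \<inter> V \<or> Z \<subseteq> B \<inter> V" using L by blast
      then show "Z \<subseteq> A \<or> Z \<subseteq> B" by blast
    qed
  next
    assume R: ?R
    show ?L
    proof (intro allI impI)
      fix A B
      assume AB: "closedin (subtopology X V) A \<and> closedin (subtopology X V) B \<and> Z \<subseteq> A \<union> B"
      then obtain A' B' where "closedin X A'" "A = A' \<inter> V" "closedin X B'" "B = B' \<inter> V"
        by (auto simp: closedin_subtopology)
      with AB R have "Z \<subseteq> A' \<or> Z \<subseteq> B'" by blast
      then show "Z \<subseteq> A \<or> Z \<subseteq> B" using \<open>A = _\<close> \<open>B = _\<close> assms by blast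
    qed
  qed
  then show ?thesis
    using assms by (auto simp: irreducible_in_def)
qed

text \<open>Chains are phrased in the ambient space, so that a chain in a subvariety is literally a
  chain in the larger variety.\<close>

definition irreducible_chain :: "'a topology \<Rightarrow> 'a set \<Rightarrow> nat \<Rightarrow> (nat \<Rightarrow> 'a set) \<Rightarrow> bool" where
  "irreducible_chain X V n Z \<longleftrightarrow>
     (\<forall>i\<le>n. closedin X (Z i) \<and> irreducible_in X (Z i) \<and> Z i \<subseteq> V) \<and> (\<forall>i<n. Z i \<subset> Z (Suc i))"

lemma krull_dim_closed_subspace:
  assumes "closedin X V"
  shows "krull_dim (subtopology X V) = Sup {ereal (real n) | n. \<exists>Z. irreducible_chain X V n Z}"
proof -
  have "closedin (subtopology X V) Z \<and> irreducible_in (subtopology X V) Z \<longleftrightarrow>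
      closedin X Z \<and> irreducible_in X Z \<and> Z \<subseteq> V" for Z
    using closedin_closed_subtopology [OF assms, of Z] irreducible_in_subtopology [of Z V X] by blast
  then show ?thesis
    unfolding krull_dim_def irreducible_chain_def by simp
qed

text \<open>Every chain in \<open>W\<close> becomes longer by putting \<open>V\<close> on top. Since
  \<open>d\<close> bounds the lengths, the supremum for \<open>W\<close> is attained by a longest
  chain, whose extension makes the inequality strict.\<close>

lemma krull_dim_proper_closed_subset_less:
  assumes V: "closedin X V" "irreducible_in X V" and W: "closedin X W" "W \<subset> V"
    and bound: "\<And>n Z. irreducible_chain X V n Z \<Longrightarrow> n \<le> d"
  shows "krull_dim (subtopology X W) < krull_dim (subtopology X V)"
proof -
  define S where "S = {n. \<exists>Z. irreducible_chain X W n Z}"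
  have extend: "ereal (real (Suc n)) \<le> krull_dim (subtopology X V)" if n: "n \<in> S" for n
  proof -
    obtain Z where Z: "irreducible_chain X W n Z" using n by (auto simp: S_def)
    have "irreducible_chain X V (Suc n) (\<lambda>i. if i \<le> n then Z i else V)"
      unfolding irreducible_chain_def
    proof (intro conjI allI impI)
      fix i assume i: "i < Suc n"
      have "Z n \<subseteq> W" using Z by (simp add: irreducible_chain_def)
      then show "(if i \<le> n then Z i else V) \<subset> (if Suc i \<le> n then Z (Suc i) else V)"
        using i Z W by (cases "i = n") (auto simp: irreducible_chain_def)
    qed (use Z V W in \<open>auto simp: irreducible_chain_def\<close>)
    then show ?thesis
      unfolding krull_dim_closed_subspace [OF V(1)] by (intro Sup_upper) blast
  qed
  have W_eq: "krull_dim (subtopology X W) = Sup ((\<lambda>n. ereal (real n)) ` S)"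
    unfolding krull_dim_closed_subspace [OF W(1)] S_def by (intro arg_cong [of _ _ Sup]) auto
  show ?thesis
  proof (cases "S = {}")
    \<comment> \<open>Without chains in \<open>W\<close> its dimension is -\<infinity>, while
      \<open>V\<close> alone is a chain of length 0.\<close>
    case True
    have "irreducible_chain X V 0 (\<lambda>_. V)"
      using V by (simp add: irreducible_chain_def)
    then have "ereal (real 0) \<le> krull_dim (subtopology X V)"
      unfolding krull_dim_closed_subspace [OF V(1)] by (intro Sup_upper) blast
    then show ?thesis
      using True by (auto simp: W_eq bot_ereal_def)
  next
    case False
    have "n \<le> d" if n: "n \<in> S" for n
    proof -
      obtain Z where "irreducible_chain X W n Z" using n by (auto simp: S_def)
      then have "irreducible_chain X V n Z" using W(2) by (auto simp: irreducible_chain_def)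
      then show ?thesis by (rule bound)
    qed
    then have fin: "finite S" by (intro finite_subset [of S "{..d}"]) auto
    have "krull_dim (subtopology X W) \<le> ereal (real (Max S))"
      unfolding W_eq using fin by (intro Sup_least) auto
    also have "\<dots> < ereal (real (Suc (Max S)))" by simp
    also have "\<dots> \<le> krull_dim (subtopology X V)"
      using extend [OF Max_in [OF fin False]] .
    finally show ?thesis .
  qed
qed

lemma (in polynomial_parametrization) variety_dim_proper_closed_subset_less:
  assumes "closedin (zariski_topology I) W" "W \<subset> image_closure"
  shows "variety_dim I W < variety_dim I image_closure"
  unfolding variety_dim_def
proof (rule krull_dim_proper_closed_subset_less
    [OF closedin_image_closure irreducible_image_closure assms])
  fix n Z assume "irreducible_chain (zariski_topology I) image_closure n Z"
  then have Z: "closedin (zariski_topology I) (Z i)" "irreducible_in (zariski_topology I) (Z i)"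
      "Z i \<subseteq> image_closure" "i < n \<Longrightarrow> Z i \<subset> Z (Suc i)" if "i \<le> n" for i
    using that by (simp_all add: irreducible_chain_def)
  show "n \<le> 2"
  \<comment> \<open>The first four members of a longer chain contradict
    \<open>no_long_chain\<close>.\<close>
  proof (rule ccontr)
    assume "\<not> n \<le> 2"
    then show False
      by (intro no_long_chain [of Z] Z) simp_all
  qed
qed

section \<open>Treks in directed trees\<close>

locale rooted_tree = pair_digraph G for G :: "nat pair_pre_digraph" +
  fixes m s :: nat
  assumes tree: "directed_tree m G"
    and root_in_verts: "s \<in> pverts G" and in_degree_root: "in_degree (with_proj G) s = 0"
begin

lemma verts_eq: "pverts G = {1..m}"
  using tree by (simp add: directed_tree_def)

text \<open>A nonempty closed walk contains a directed cycle.\<close>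

lemma closed_awalk_Nil: "awalk u p u \<Longrightarrow> p = []"
  using tree closed_w_imp_cycle [of p]
  by (auto simp: directed_tree_def forest_def closed_w_def)

lemma no_arc_into_root: "(i, s) \<notin> parcs G"
proof
  assume "(i, s) \<in> parcs G"
  then have "(i, s) \<in> in_arcs (with_proj G) s"
    by (simp add: in_arcs_def)
  moreover have "in_arcs (with_proj G) s = {}"
    using in_degree_root finite_in_arcs [of s] by (simp add: in_degree_def)
  ultimately show False by blast
qed

lemma parent_ex:
  assumes "v \<in> pverts G" "v \<noteq> s"
  obtains u where "(u, v) \<in> parcs G"
proof -
  have "\<exists>!t. t \<in> pverts G \<and> in_degree (with_proj G) t = 0"
    using tree unfolding directed_tree_def by (elim conjE)
  then obtain t where t: "\<And>u. u \<in> pverts G \<Longrightarrow> in_degree (with_proj G) u = 0 \<Longrightarrow> u = t"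
    unfolding Ex1_def by blast
  have "in_degree (with_proj G) v \<noteq> 0"
    using t [OF assms(1)] t [OF root_in_verts in_degree_root] assms(2) by metis
  then have "in_arcs (with_proj G) v \<noteq> {}"
    by (metis card.empty in_degree_def)
  then obtain e where "e \<in> parcs G" "snd e = v"
    by (auto simp: in_arcs_def)
  then show thesis
    by (intro that [of "fst e"]) auto
qed

lemma wf_parcs: "wf (parcs G)"
proof (rule finite_acyclic_wf [OF pair_finite_arcs])
  show "acyclic (parcs G)"
    unfolding acyclic_def reachable1_awalk by (blast dest: closed_awalk_Nil)
qed

text \<open>Passing from a vertex to a parent terminates by well-foundedness and can stop only at
  \<open>s\<close>.\<close>

lemma awalk_from_root: "v \<in> pverts G \<Longrightarrow> \<exists>p. awalk s p v"
proof (induction v rule: wf_induct_rule [OF wf_parcs])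
  case (1 v)
  show ?case
  proof (cases "v = s")
    case True
    then show ?thesis
      using root_in_verts by (intro exI [of _ "[]"]) (simp add: awalk_Nil_iff)
  next
    case False
    then obtain u where u: "(u, v) \<in> parcs G" using parent_ex 1(2) by blast
    then obtain p where "awalk s p u" using 1(1) [OF u] in_arcsD1 [OF u] by blast
    then have "awalk s (p @ [(u, v)]) v"
      using arc_implies_awalk [OF u] by (intro awalk_appendI) simp_all
    then show ?thesis ..
  qed
qed

text \<open>A repeated vertex would give a nonempty closed walk. Treks can thus be built from walks,
  which concatenate freely.\<close>

lemma apath_eq_awalk: "apath u p v \<longleftrightarrow> awalk u p v"
proof
  assume p: "awalk u p v"
  have "distinct (pawalk_verts u p)"
  proof (rule ccontr)
    assume "\<not> distinct (pawalk_verts u p)"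
    then obtain r w where "0 < length r" "awalk w r w"
      using awalk_not_distinct_decomp [OF p] by blast
    then show False
      using closed_awalk_Nil [of w r] by simp
  qed
  with p show "apath u p v" by (simp add: apath_def)
qed (simp add: apath_def)

lemma awalk_snoc_iff:
  "awalk u (p @ [e]) v \<longleftrightarrow> awalk u p (fst e) \<and> e \<in> parcs G \<and> snd e = v"
proof
  assume "awalk u (p @ [e]) v"
  then show "awalk u p (fst e) \<and> e \<in> parcs G \<and> snd e = v"
    by (auto simp: awalk_simps)
next
  assume "awalk u p (fst e) \<and> e \<in> parcs G \<and> snd e = v"
  then show "awalk u (p @ [e]) v"
    using awalk_appendI [OF _ arc_implies_awalk [of e], of u p] by simp
qed

text \<open>
  Paths from the root to two distinct parents of \<open>j\<close> avoid \<open>j\<close>; together with the arcs into \<open>j\<close>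
  they contain an undirected cycle.
\<close>
lemma parent_unique:
  assumes "(i, j) \<in> parcs G" "(i', j) \<in> parcs G"
  shows "i = i'"
proof (rule ccontr)
  assume "i \<noteq> i'"
  let ?S = "mk_symmetric (with_proj G)"
  interpret S: pair_digraph ?S ..
  have arcs_S: "parcs ?S = parcs G \<union> prod.swap ` parcs G"
    by (auto simp: parcs_mk_symmetric)
  have S_awalk: "S.awalk u p v" if "awalk u p v" for u p v
    using that by (induction p arbitrary: u) (auto simp: S.awalk_simps awalk_simps arcs_S)
  have S_awalk_rev: "S.awalk v (rev (map prod.swap p)) u" if "awalk u p v" for u p v
    using that
  proof (induction p arbitrary: u)
    case Nil
    then show ?case by (auto simp: S.awalk_simps awalk_simps)
  next
    case (Cons e p)
    then have "S.awalk v (rev (map prod.swap p)) (snd e)" "S.awalk (snd e) [prod.swap e] u"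
      by (auto simp: S.awalk_simps awalk_simps arcs_S intro: arc_fst_in_verts)
    then show ?case using S.awalk_appendI by simp
  qed
  \<comment> \<open>If the walk met \<open>j\<close>, its tail followed by the arc
    \<open>(k, j)\<close> would be a nonempty closed walk.\<close>
  have avoid: "\<forall>e\<in>set p. fst e \<noteq> j \<and> snd e \<noteq> j"
    if p: "awalk s p k" and k: "(k, j) \<in> parcs G" for p k
  proof (rule ccontr)
    assume "\<not> ?thesis"
    then have "j \<in> set (pawalk_verts s p)"
      using set_awalk_verts [OF p] by auto
    then obtain q where "awalk j q k"
      using awalk_decomp [OF p] by blast
    then have "awalk j (q @ [(k, j)]) j"
      using k by (simp add: awalk_snoc_iff del: awalk_append_iff)
    then have "q @ [(k, j)] = []"
      by (rule closed_awalk_Nil)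
    then show False by simp
  qed
  \<comment> \<open>The walk \<open>?w\<close> runs from \<open>i\<close> back to \<open>s\<close>
    and down to \<open>i'\<close>; shortened to a path \<open>r\<close> it still avoids
    \<open>j\<close>, so \<open>j\<close> closes it to a cycle. As \<open>i \<noteq> i'\<close>,
    \<open>r\<close> is nonempty and the cycle has at least 3 arcs.\<close>
  obtain p where p: "awalk s p i" using awalk_from_root assms(1) in_arcsD1 by blast
  obtain p' where p': "awalk s p' i'" using awalk_from_root assms(2) in_arcsD1 by blast
  let ?w = "rev (map prod.swap p) @ p'"
  have w: "S.awalk i ?w i'"
    using S_awalk_rev [OF p] S_awalk [OF p'] by (rule S.awalk_appendI)
  have w_avoid: "\<forall>e\<in>set ?w. fst e \<noteq> j \<and> snd e \<noteq> j"
    using avoid [OF p assms(1)] avoid [OF p' assms(2)] by auto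
  define r where "r = S.awalk_to_apath ?w"
  have r: "S.apath i r i'" and r_sub: "set r \<subseteq> set ?w"
    unfolding r_def using S.apath_awalk_to_apath [OF w] S.awalk_to_apath_subset [OF w] by auto
  have r_awalk: "S.awalk i r i'" and r_distinct: "distinct (pawalk_verts i r)"
    using r by (simp_all add: S.apath_def)
  have "r \<noteq> []"
    using r_awalk \<open>i \<noteq> i'\<close> by (auto simp: S.awalk_simps)
  have "i \<noteq> j" using assms(1) no_loops' by blast
  then have j: "j \<notin> set (pawalk_verts i r)"
    using S.set_awalk_verts [OF r_awalk] w_avoid r_sub by auto
  let ?c = "(j, i) # r @ [(i', j)]"
  have "S.awalk i' [(i', j)] j" "(j, i) \<in> parcs ?S"
    using assms in_arcsD2 imageI [OF assms(1), of prod.swap] by (auto simp: S.awalk_simps arcs_S)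
  then have c: "S.awalk j ?c j"
    using S.awalk_appendI [OF r_awalk, of "[(i', j)]" j]
    by (simp add: S.awalk_Cons_iff del: S.awalk_append_iff)
  have "pawalk_verts i (r @ [(i', j)]) = pawalk_verts i r @ [j]"
    using S.awalk_verts_append [of i r "[(i', j)]" j] c r_awalk by (simp add: S.awalk_Cons_iff)
  then have "distinct (tl (pawalk_verts j ?c))"
    using r_distinct j by simp
  then have "S.cycle ?c"
    unfolding S.cycle_def using c by (intro exI [of _ j] conjI) simp_all
  moreover have "3 \<le> length ?c"
    using \<open>r \<noteq> []\<close> by (cases r) auto
  ultimately show False
    using tree unfolding directed_tree_def by blast
qed

lemma treks_iff: "(P, Q) \<in> treks G i j \<longleftrightarrow> (\<exists>k. awalk k P i \<and> awalk k Q j)"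
  by (simp add: treks_def apath_eq_awalk)

text \<open>Over an infinite set the sum in \<open>trek_poly\<close> would default to 0.\<close>

lemma finite_treks: "finite (treks G i j)"
proof -
  have "finite ((fst \<circ> snd) ` {(u, p, v). apath u p v})" (is "finite ?A")
    using apaths_finite_triple by (rule finite_imageI)
  moreover have "treks G i j \<subseteq> ?A \<times> ?A"
    by (force simp: treks_def)
  ultimately show ?thesis
    by (meson finite_SigmaI finite_subset)
qed

lemma trek_poly_root: "trek_poly G s s \<omega> l = \<omega>"
proof -
  have "P = [] \<and> k = s" if "awalk k P s" for k P
    using that no_arc_into_root by (cases P rule: rev_cases) (auto simp: awalk_snoc_iff awalk_simps simp del: awalk_append_iff)
  then have "treks G s s = {([], [])}"
    using root_in_verts by (auto simp: treks_iff awalk_simps)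
  then show ?thesis by (simp add: trek_poly_def)
qed

text \<open>The walk to \<open>j\<close> cannot be empty, since then the other walk would lead from
  \<open>j\<close> to its parent \<open>i\<close>. Its last arc is \<open>(i, j)\<close> because
  parents are unique.\<close>

lemma treks_arc:
  assumes "(i, j) \<in> parcs G"
  shows "treks G i j = (\<lambda>(P, Q). (P, Q @ [(i, j)])) ` treks G i i" (is "?L = ?R")
proof (intro set_eqI iffI)
  fix t assume "t \<in> ?L"
  then obtain P Q k where t: "t = (P, Q)" "awalk k P i" "awalk k Q j"
    by (cases t) (auto simp: treks_iff)
  show "t \<in> ?R"
  proof (cases Q rule: rev_cases)
    case Nil
    then have "awalk j (P @ [(i, j)]) j"
      using t assms by (simp add: awalk_snoc_iff awalk_simps del: awalk_append_iff)
    then have "P @ [(i, j)] = []"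
      by (rule closed_awalk_Nil)
    then show ?thesis by simp
  next
    case (snoc Q' e)
    then have "awalk k Q' (fst e)" "e \<in> parcs G" "snd e = j"
      using t(3) by (simp_all add: awalk_snoc_iff del: awalk_append_iff)
    then have "e = (i, j)" "awalk k Q' i"
      using parent_unique [OF assms, of "fst e"] by (cases e; simp)+
    then show ?thesis
      using t snoc by (force simp: treks_iff)
  qed
next
  fix t assume "t \<in> ?R"
  then show "t \<in> ?L"
    using assms by (auto simp: treks_iff awalk_snoc_iff simp del: awalk_append_iff)
qed

text \<open>A trek starting at \<open>j\<close> is trivial by acyclicity; in any other trek both
  walks end with the arc from the only parent.\<close>

lemma treks_child:
  assumes "(i, j) \<in> parcs G"
  shows "treks G j j = insert ([], []) ((\<lambda>(P, Q). (P @ [(i, j)], Q @ [(i, j)])) ` treks G i i)"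
    (is "?L = ?R")
proof (intro set_eqI iffI)
  fix t assume "t \<in> ?L"
  then obtain P Q k where t: "t = (P, Q)" "awalk k P j" "awalk k Q j"
    by (cases t) (auto simp: treks_iff)
  have last_arc: "k = j \<or> (\<exists>p'. p = p' @ [(i, j)] \<and> awalk k p' i)" if "awalk k p j" for p
  proof (cases p rule: rev_cases)
    case Nil
    then show ?thesis using that by (simp add: awalk_simps)
  next
    case (snoc p' e)
    then have "awalk k p' (fst e)" "e \<in> parcs G" "snd e = j"
      using that by (simp_all add: awalk_snoc_iff del: awalk_append_iff)
    moreover from this have "e = (i, j)"
      using parent_unique [OF assms, of "fst e"] by (cases e) simp
    ultimately show ?thesis using snoc by simp
  qed
  show "t \<in> ?R"
  proof (cases "k = j")
    case True
    then show ?thesis using t closed_awalk_Nil by blast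
  next
    case False
    then obtain P' Q' where "P = P' @ [(i, j)]" "awalk k P' i" "Q = Q' @ [(i, j)]" "awalk k Q' i"
      using last_arc t by blast
    then show ?thesis using t by (force simp: treks_iff)
  qed
next
  fix t assume "t \<in> ?R"
  then show "t \<in> ?L"
    using assms in_arcsD2 [OF assms]
    by (auto simp: treks_iff awalk_snoc_iff awalk_Nil_iff simp del: awalk_append_iff)
qed

lemma trek_poly_arc:
  assumes "(i, j) \<in> parcs G"
  shows "trek_poly G i j \<omega> l = l * trek_poly G i i \<omega> l"
proof -
  have "inj_on (\<lambda>(P, Q). (P, Q @ [(i, j)])) (treks G i i)"
    by (auto simp: inj_on_def)
  then show ?thesis
    unfolding trek_poly_def treks_arc [OF assms]
    by (simp add: sum.reindex sum_distrib_left split_def algebra_simps)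
qed

lemma trek_poly_child:
  assumes "(i, j) \<in> parcs G"
  shows "trek_poly G j j \<omega> l = \<omega> + l\<^sup>2 * trek_poly G i i \<omega> l"
proof -
  have inj: "inj_on (\<lambda>t. (fst t @ [(i, j)], snd t @ [(i, j)])) (treks G i i)"
    by (auto simp: inj_on_def)
  show ?thesis
    unfolding trek_poly_def treks_child [OF assms]
    by (subst sum.insert)
       (auto simp: finite_treks sum.reindex [OF inj] sum_distrib_left split_def power2_eq_square
          algebra_simps)
qed

lemma trek_poly_pos:
  assumes "i \<in> pverts G" "j \<in> pverts G" "\<omega> > 0" "l > 0"
  shows "trek_poly G i j \<omega> l > 0"
proof -
  obtain P Q where "awalk s P i" "awalk s Q j"
    using awalk_from_root assms(1,2) by blast
  then have "treks G i j \<noteq> {}"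
    by (metis treks_iff empty_iff)
  then show ?thesis
    unfolding trek_poly_def using assms(3,4) by (intro sum_pos finite_treks) auto
qed

lemma trek_poly_nonroot_ge:
  assumes "j \<in> pverts G" "j \<noteq> s" "l > 0"
  shows "trek_poly G j j 1 l \<ge> 1 + l\<^sup>2"
  using assms
proof (induction j rule: wf_induct_rule [OF wf_parcs])
  case (1 j)
  then obtain i where i: "(i, j) \<in> parcs G" using parent_ex by blast
  then have "i \<in> pverts G" by (rule in_arcsD1)
  then have "trek_poly G i i 1 l \<ge> 1"
  proof (cases "i = s")
    case False
    then have "trek_poly G i i 1 l \<ge> 1 + l\<^sup>2" using 1 i \<open>i \<in> pverts G\<close> by blast
    then show ?thesis using zero_le_power2 [of l] by linarith
  qed (simp add: trek_poly_root)
  then have "l\<^sup>2 * 1 \<le> l\<^sup>2 * trek_poly G i i 1 l"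
    by (intro mult_left_mono) simp_all
  then show ?case by (simp add: trek_poly_child [OF i])
qed

lemma trek_poly_diag_ge_1:
  assumes "i \<in> pverts G" "l > 0"
  shows "trek_poly G i i 1 l \<ge> 1"
proof (cases "i = s")
  case False
  then show ?thesis
    using trek_poly_nonroot_ge [of i l] assms zero_le_power2 [of l] by linarith
qed (simp add: trek_poly_root)

text \<open>Every trek between distinct nonadjacent vertices has at least two edges, so the
  polynomial has order at least 2 at \<lambda> = 0.\<close>

lemma trek_poly_nonadjacent_le:
  assumes "i \<noteq> j" "(i, j) \<notin> parcs G" "(j, i) \<notin> parcs G" "0 < l" "l \<le> 1"
  shows "trek_poly G i j 1 l \<le> real (card (treks G i j)) * l\<^sup>2"
proof -
  have "l ^ (length P + length Q) \<le> l\<^sup>2" if PQ: "(P, Q) \<in> treks G i j" for P Q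
  proof -
    obtain k where k: "awalk k P i" "awalk k Q j" using PQ by (auto simp: treks_iff)
    have "2 \<le> length P + length Q"
    proof (rule ccontr)
      assume "\<not> 2 \<le> length P + length Q"
      then consider "P = []" "Q = []" | e where "P = [e]" "Q = []" | e where "P = []" "Q = [e]"
        by (cases P; cases Q) (auto simp: Suc_le_eq)
      then show False
        using k assms(1-3) by cases (auto simp: awalk_simps)
    qed
    then show ?thesis using assms(4,5) by (intro power_decreasing) simp_all
  qed
  then have "trek_poly G i j 1 l \<le> (\<Sum>t\<in>treks G i j. l\<^sup>2)"
    unfolding trek_poly_def by (intro sum_mono) auto
  then show ?thesis by simp
qed

text \<open>
  Eliminates the parameters from \<open>p\<^sub>j\<^sub>j = \<omega> + \<lambda>\<^sup>2 p\<^sub>i\<^sub>i\<close>, \<open>p\<^sub>i\<^sub>j = \<lambda> p\<^sub>i\<^sub>i\<close> and \<open>p\<^sub>s\<^sub>s = \<omega>\<close>.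
\<close>
lemma arc_relation:
  assumes "(i, j) \<in> parcs G"
  shows "trek_poly G i i \<omega> l * trek_poly G j j \<omega> l - (trek_poly G i j \<omega> l)\<^sup>2
    = trek_poly G s s \<omega> l * trek_poly G i i \<omega> l"
  by (simp add: trek_poly_arc [OF assms] trek_poly_child [OF assms] trek_poly_root
      algebra_simps power2_eq_square)

end

section \<open>Recovering a tree from its arc relations\<close>

lemma directed_tree_rooted:
  assumes "directed_tree m G"
  obtains s where "rooted_tree G m s"
proof -
  obtain s where "s \<in> pverts G" "in_degree (with_proj G) s = 0"
    using assms unfolding directed_tree_def by blast
  moreover have "pair_digraph G" using assms by (simp add: directed_tree_def)
  ultimately show thesis
    using assms by (intro that [of s]) (simp add: rooted_tree_def rooted_tree_axioms_def)
qed

lemma treks_swap: "treks G j i = prod.swap ` treks G i j"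
  unfolding treks_def by (auto simp: image_iff)

text \<open>Coordinates exist only for \<open>i \<le> j\<close>, whereas arcs may run either
  way.\<close>

lemma trek_poly_commute: "trek_poly G j i \<omega> l = trek_poly G i j \<omega> l"
  unfolding trek_poly_def treks_swap [of G j i]
  by (simp add: sum.reindex split_def add.commute)

lemma trees_eq_of_arc_relations:
  assumes "rooted_tree G m r" "rooted_tree H m s"
    and rel: "\<And>i j l. (i, j) \<in> parcs H \<Longrightarrow>
      trek_poly G i i 1 l * trek_poly G j j 1 l - (trek_poly G i j 1 l)\<^sup>2
      = trek_poly G s s 1 l * trek_poly G i i 1 l"
  shows "G = H"
proof -
  interpret G: rooted_tree G m r by fact
  interpret H: rooted_tree H m s by fact
  have verts: "pverts G = pverts H"
    by (simp add: G.verts_eq H.verts_eq)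
  have "r = s"
  proof (rule ccontr)
    assume "r \<noteq> s"
    then obtain i where i: "(i, r) \<in> parcs H"
      using H.parent_ex G.root_in_verts verts by metis
    then have "i \<in> pverts G" using H.in_arcsD1 verts by simp
    then have "trek_poly G i r 1 1 > 0" and pos: "trek_poly G i i 1 1 > 0"
      using G.trek_poly_pos G.root_in_verts by simp_all
    \<comment> \<open>The relation of the arc \<open>(i, r)\<close> with \<open>p_rr = 1\<close> and
      \<open>p_ir > 0\<close>; it would push \<open>p_ss\<close> below 1.\<close>
    then have "trek_poly G s s 1 1 * trek_poly G i i 1 1 < trek_poly G i i 1 1 * 1"
      using rel [OF i, of 1] by (simp add: G.trek_poly_root flip: rel [OF i, of 1])
    then have "trek_poly G s s 1 1 < 1"
      using pos by simp
    then show False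
      using G.trek_poly_diag_ge_1 [of s 1] H.root_in_verts verts by simp
  qed
  have "(i, j) \<in> parcs G" if ij: "(i, j) \<in> parcs H" for i j
  proof -
    have verts_ij: "i \<in> pverts G" "j \<in> pverts G" and "i \<noteq> j"
      using ij H.in_arcsD1 H.in_arcsD2 H.no_loops' verts by auto
    have "j \<noteq> r" using ij H.no_arc_into_root \<open>r = s\<close> by blast
    have rel': "trek_poly G i i 1 l * trek_poly G j j 1 l - (trek_poly G i j 1 l)\<^sup>2
        = trek_poly G i i 1 l" for l
      using rel [OF ij, of l] by (simp add: G.trek_poly_root flip: \<open>r = s\<close>)
    have adjacent: "(i, j) \<in> parcs G \<or> (j, i) \<in> parcs G"
    proof (rule ccontr)
      assume nonadj: "\<not> ?thesis"
      define N where "N = card (treks G i j)"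
      \<comment> \<open>Chosen so that \<open>real N * l < 1\<close>, whereas the relation will give
        \<open>l \<le> real N * l\<^sup>2\<close>.\<close>
      define l where "l = 1 / (real N + 1)"
      have l: "0 < l" "l \<le> 1" by (simp_all add: l_def field_simps)
      have "1 * l\<^sup>2 \<le> trek_poly G i i 1 l * (trek_poly G j j 1 l - 1)"
        using G.trek_poly_diag_ge_1 [OF verts_ij(1) l(1)]
          G.trek_poly_nonroot_ge [OF verts_ij(2) \<open>j \<noteq> r\<close> l(1)]
        by (intro mult_mono) simp_all
      also have "\<dots> = (trek_poly G i j 1 l)\<^sup>2"
        using rel' [of l] by (simp add: algebra_simps)
      finally have "l \<le> trek_poly G i j 1 l"
        using G.trek_poly_pos [OF verts_ij, of 1 l] l by (simp add: power2_le_iff_abs_le)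
      also have "\<dots> \<le> real N * l\<^sup>2"
        unfolding N_def using G.trek_poly_nonadjacent_le [OF \<open>i \<noteq> j\<close> _ _ l] nonadj by blast
      finally have "1 \<le> real N * l" using l by (simp add: power2_eq_square)
      then show False by (simp add: l_def field_simps)
    qed
    have "(j, i) \<notin> parcs G"
    proof
      assume ji: "(j, i) \<in> parcs G"
      \<comment> \<open>The relations of \<open>(i, j)\<close> in \<open>H\<close> and of
        \<open>(j, i)\<close> in \<open>G\<close> share their left side. The recursion along
        \<open>(j, i)\<close> gives \<open>p_ii = 1 + p_jj\<close> instead.\<close>
      have "trek_poly G i i 1 1 = trek_poly G j j 1 1"
        using rel' [of 1] G.arc_relation [OF ji, of 1 1]
        by (simp add: G.trek_poly_root trek_poly_commute [of G j i] mult.commute)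
      then show False
        using G.trek_poly_child [OF ji, of 1 1] by simp
    qed
    with adjacent show ?thesis by blast
  qed
  then have sub: "parcs H \<subseteq> parcs G" by auto
  \<comment> \<open>The head of an arc of \<open>G\<close> has a parent in \<open>H\<close>, which
    by \<open>sub\<close> is its unique parent in \<open>G\<close>.\<close>
  have "parcs G \<subseteq> parcs H"
  proof
    fix e assume e: "e \<in> parcs G"
    then have "snd e \<noteq> s" "snd e \<in> pverts H"
      using G.no_arc_into_root \<open>r = s\<close> G.arc_snd_in_verts verts by (cases e; auto)+
    then obtain i where i: "(i, snd e) \<in> parcs H"
      using H.parent_ex by blast
    then have "i = fst e"
      using sub e by (intro G.parent_unique [of _ "snd e"]) auto
    with i show "e \<in> parcs H" by simp
  qed
  with sub verts show "G = H"
    by (intro pair_pre_digraph.equality) auto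
qed

section \<open>Tree varieties\<close>

lemma trek_poly_bivariate: "\<exists>Q. \<forall>\<omega> l. trek_poly G i j \<omega> l = eval2 Q \<omega> l"
proof (intro exI allI)
  fix \<omega> l
  \<comment> \<open>\<open>[:0, monom 1 n:]\<close> encodes the monomial of degree 1 in \<omega> and
    degree \<open>n\<close> in \<lambda>.\<close>
  show "trek_poly G i j \<omega> l =
      eval2 (\<Sum>(P, Q)\<in>treks G i j. [:0, monom 1 (length P + length Q):]) \<omega> l"
    by (simp add: trek_poly_def split_def) (simp add: eval2_def poly_monom)
qed

lemma polynomial_parametrization_trek_map:
  "polynomial_parametrization (cov_coords m) (trek_map m G)"
proof
  show "trek_map m G z \<in> cov_coords m \<rightarrow>\<^sub>E UNIV" for z
    by (cases z) (simp add: trek_map_def)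
  fix c assume "c \<in> cov_coords m"
  then show "\<exists>Q. \<forall>\<omega> l. trek_map m G (\<omega>, l) c = eval2 Q \<omega> l"
    using trek_poly_bivariate [of G "fst c" "snd c"] by (simp add: trek_map_def split_def)
qed

lemma tree_variety_eq_image_closure:
  "tree_variety m G = polynomial_parametrization.image_closure (cov_coords m) (trek_map m G)"
  using polynomial_parametrization.image_closure_def [OF polynomial_parametrization_trek_map]
  by (simp add: tree_variety_def tree_model_def)

lemma closedin_tree_variety: "closedin (zariski_topology (cov_coords m)) (tree_variety m G)"
  by (simp add: tree_variety_def)

lemma tree_variety_subset_imp_eq:
  assumes "directed_tree m G" "directed_tree m H" "tree_variety m G \<subseteq> tree_variety m H"
  shows "G = H"
proof -
  obtain r where "rooted_tree G m r" using directed_tree_rooted [OF assms(1)] .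
  obtain s where "rooted_tree H m s" using directed_tree_rooted [OF assms(2)] .
  interpret H: rooted_tree H m s by fact
  interpret PG: polynomial_parametrization "cov_coords m" "trek_map m G"
    by (rule polynomial_parametrization_trek_map)
  interpret PH: polynomial_parametrization "cov_coords m" "trek_map m H"
    by (rule polynomial_parametrization_trek_map)
  define co where "co i j = (min i j, max i j)" for i j :: nat
  have co: "co i j \<in> cov_coords m" if "i \<in> pverts H" "j \<in> pverts H" for i j
    using that by (auto simp: co_def cov_coords_def H.verts_eq)
  have trek_map_co: "trek_map m K (\<omega>, l) (co i j) = trek_poly K i j \<omega> l"
    if "i \<in> pverts H" "j \<in> pverts H" for K i j \<omega> l
    using co [OF that] trek_poly_commute [of K j i]
    by (cases "i \<le> j") (auto simp: trek_map_def co_def min_def max_def)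
  show "G = H"
  proof (rule trees_eq_of_arc_relations)
    fix i j l assume ij: "(i, j) \<in> parcs H"
    note v = H.in_arcsD1 [OF ij] H.in_arcsD2 [OF ij] H.root_in_verts
    \<comment> \<open>The arc relation of \<open>H\<close> as a polynomial function. It vanishes on
      the variety of \<open>H\<close>, hence at the points of the model of \<open>G\<close>.\<close>
    define f where "f x = x (co i i) * x (co j j) - x (co i j) ^ 2 - x (co s s) * x (co i i)"
      for x :: "nat \<times> nat \<Rightarrow> real"
    have "f (trek_map m G (1, l)) = 0"
    proof (rule PH.zero_on_image_closure [where f = f])
      show "f \<in> poly_funs (cov_coords m)"
        unfolding f_def
        by (intro poly_funs_diff poly_funs.poly_mult poly_funs_power poly_funs.poly_coord co v)
      show "f (trek_map m H (\<omega>, l)) = 0" for \<omega> l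
        using H.arc_relation [OF ij, of \<omega> l] by (simp add: f_def trek_map_co v)
      show "trek_map m G (1, l) \<in> PH.image_closure"
        using PG.image_subset_closure assms(3) by (force simp: tree_variety_eq_image_closure)
    qed
    then show "trek_poly G i i 1 l * trek_poly G j j 1 l - (trek_poly G i j 1 l)\<^sup>2
      = trek_poly G s s 1 l * trek_poly G i i 1 l"
      by (simp add: f_def trek_map_co v)
  qed fact+
qed

lemma variety_dim_inter_less:
  assumes "directed_tree m G" "directed_tree m H" "G \<noteq> H"
  shows "variety_dim (cov_coords m) (tree_variety m G \<inter> tree_variety m H)
    < variety_dim (cov_coords m) (tree_variety m G)"
proof -
  interpret polynomial_parametrization "cov_coords m" "trek_map m G"
    by (rule polynomial_parametrization_trek_map)
  have "tree_variety m G \<inter> tree_variety m H \<subset> tree_variety m G"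
    using tree_variety_subset_imp_eq assms by blast
  then show ?thesis
    using variety_dim_proper_closed_subset_less closedin_tree_variety
    by (metis closedin_Int tree_variety_eq_image_closure)
qed

theorem mainTheorem8:
  fixes m :: nat and G H :: "nat pair_pre_digraph"
  assumes "directed_tree m G" and "directed_tree m H" and "G \<noteq> H"
  shows "variety_dim (cov_coords m) (tree_variety m G \<inter> tree_variety m H)
           < min (variety_dim (cov_coords m) (tree_variety m G))
                 (variety_dim (cov_coords m) (tree_variety m H))
         \<and> tree_model m G \<noteq> tree_model m H"
proof
  show "variety_dim (cov_coords m) (tree_variety m G \<inter> tree_variety m H)
      < min (variety_dim (cov_coords m) (tree_variety m G))
            (variety_dim (cov_coords m) (tree_variety m H))"
    using variety_dim_inter_less [OF assms] variety_dim_inter_less [OF assms(2,1)] assms(3)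
    by (simp add: Int_commute)
  \<comment> \<open>Equal models would have equal Zariski closures.\<close>
  show "tree_model m G \<noteq> tree_model m H"
    using tree_variety_subset_imp_eq [OF assms(1,2)] assms(3) by (auto simp: tree_variety_def)
qed

end
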